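(* Let $n,N\ge 1$, let $(\mathbf{x}^{(i)},y^{(i)})_{i=1}^N \subseteq \mathbb{R}^n\times\mathbb{R}$ be a dataset with $\mathbf{y}=(y^{(1)},\dots,y^{(N)})^\top$, let $W\subseteq\mathbb{Z}^n_{\ge 0}$ be a finite set containing $\mathbf{0}$, and let $\mathbf{X}\in\mathbb{R}^{N\times|W|}$ be the matrix with entries $\mathbf{X}_{i,\mathbf{w}}=\mathbf{w}^\top\mathbf{x}^{(i)}$. Define $\mathcal{L}:\mathbb{R}^{W}\times\mathbb{R}^{W}\to\mathbb{R}$ by $$\mathcal{L}(\mathbf{p},\mathbf{q})=\|\mathbf{X}\boxplus\mathbf{p}-\mathbf{X}\boxplus\mathbf{q}-\mathbf{y}\|_\infty .$$ Let $(\mathbf{p}^k,\mathbf{q}^k)_{k\ge 0}$ be the iterates of the alternating minimization algorithm described in the context. Then for every $k\ge 1$ the gradient $\nabla\mathcal{L}(\mathbf{p}^k,\mathbf{q}^k)$ does not exist, i.e. $\mathcal{L}$ is not differentiable at $(\mathbf{p}^k,\mathbf{q}^k)$.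
   Context: Max-plus and min-plus matrix-vector products: for an $m\times r$ matrix $\mathbf{A}$ and a vector $\mathbf{u}$ of length $r$, $(\mathbf{A}\boxplus\mathbf{u})_i=\max_{1\le j\le r}(a_{i,j}+u_j)$ and $(\mathbf{A}\boxplus'\mathbf{u})_i=\min_{1\le j\le r}(a_{i,j}+u_j)$. Adding a scalar to a vector means adding it to every entry. Entries of vectors may be $-\infty$, with $a+(-\infty)=-\infty$. Alternating minimization algorithm (input: dataset and $W$). Columns of $\mathbf{X}$ and coefficient vectors $\mathbf{p}=(p_\mathbf{w})_{\mathbf{w}\in W}$, $\mathbf{q}=(q_\mathbf{w})_{\mathbf{w}\in W}$ are indexed by $W$. Initialize all entries of $\mathbf{p}^0$ and $\mathbf{q}^0$ to $-\infty$, except $q^0_{\mathbf{0}}=-\frac1N\sum_{i=1}^N y^{(i)}$. For $k=1,2,\dots$ set $$\mathbf{p}^k\in\arg\min_{\mathbf{p}}\|\mathbf{X}\boxplus\mathbf{p}-\mathbf{X}\boxplus\mathbf{q}^{k-1}-\mathbf{y}\|_\infty,\qquad \mathbf{q}^k\in\arg\min_{\mathbf{q}}\|\mathbf{X}\boxplus\mathbf{p}^k-\mathbf{X}\boxplus\mathbf{q}-\mathbf{y}\|_\infty,$$ where the minimizer chosen is the closed-form one: a minimizer of $\|\mathbf{X}\boxplus\mathbf{u}-\mathbf{b}\|_\infty$ over $\mathbf{u}$ is $\hat{\mathbf{u}}+\frac12\|\mathbf{X}\boxplus\hat{\mathbf{u}}-\mathbf{b}\|_\infty$ with $\hat{\mathbf{u}}=(-\mathbf{X}^\top)\boxplus'\mathbf{b}$;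 it is applied with $\mathbf{b}=\mathbf{X}\boxplus\mathbf{q}^{k-1}+\mathbf{y}$ to obtain $\mathbf{p}^k$ and with $\mathbf{b}=\mathbf{X}\boxplus\mathbf{p}^k-\mathbf{y}$ to obtain $\mathbf{q}^k$. All entries of $\mathbf{p}^k,\mathbf{q}^k$ are finite for $k\ge 1$. *)

theory Defs
  imports "HOL-Analysis.Analysis"
begin

definition maxplus_mv :: "'a::{linorder,plus}^'r^'m \<Rightarrow> 'a^'r \<Rightarrow> 'a^'m"  (infixl "\<boxplus>" 70)
  where "A \<boxplus> u = (\<chi> i. Max (range (\<lambda>j. A $ i $ j + u $ j)))"

definition minplus_mv :: "'a::{linorder,plus}^'r^'m \<Rightarrow> 'a^'r \<Rightarrow> 'a^'m"  (infixl "\<boxplus>''" 70)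
  where "A \<boxplus>' u = (\<chi> i. Min (range (\<lambda>j. A $ i $ j + u $ j)))"

text \<open>
  The maximum norm for vectors of extended reals; on real vectors it agrees with
  \<^const>\<open>infnorm\<close>, see \<open>einfnorm_ereal\<close> below.
\<close>

definition einfnorm :: "ereal^'m \<Rightarrow> ereal"
  where "einfnorm v = Max (range (\<lambda>i. \<bar>v $ i\<bar>))"

definition ereal_vec :: "real^'m \<Rightarrow> ereal^'m"
  where "ereal_vec v = (\<chi> i. ereal (v $ i))"

definition real_vec :: "ereal^'m \<Rightarrow> real^'m"
  where "real_vec v = (\<chi> i. real_of_ereal (v $ i))"

text \<open>
  The closed-form minimizer of \<open>\<parallel>A \<boxplus> u - b\<parallel>\<^sub>\<infinity>\<close> over \<open>u\<close>; \<^const>\<open>vec\<close> turns a scalar into a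
  constant vector.
\<close>

definition maxplus_fit :: "ereal^'r^'m \<Rightarrow> ereal^'m \<Rightarrow> ereal^'r"
  where "maxplus_fit A b =
    (let u = (- transpose A) \<boxplus>' b in u + vec (einfnorm (A \<boxplus> u - b) / 2))"

text \<open>
  The finite exponent set \<open>W\<close> is indexed by a finite type \<open>'w\<close> through an enumeration
  \<open>\<omega>\<close>; column \<open>j\<close> belongs to the exponent \<open>\<omega> j\<close>. Row \<open>i\<close> of \<open>x\<close> is the \<open>i\<close>-th data point.
\<close>

definition exponent_matrix :: "('w::finite \<Rightarrow> nat^'n) \<Rightarrow> real^'n^'m \<Rightarrow> real^'w^'m"
  where "exponent_matrix \<omega> x = (\<chi> i j. (\<chi> l. real (\<omega> j $ l)) \<bullet> (x $ i))"

definition loss ::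
  "('w::finite \<Rightarrow> nat^'n) \<Rightarrow> real^'n^'m \<Rightarrow> real^'m \<Rightarrow> (real^'w) \<times> (real^'w) \<Rightarrow> real"
  where "loss \<omega> x y = (\<lambda>(p, q).
    infnorm (exponent_matrix \<omega> x \<boxplus> p - exponent_matrix \<omega> x \<boxplus> q - y))"

text \<open>
  The iterates live in the extended reals because of the entries \<open>-\<infinity>\<close> of the
  initial vectors; from the first iteration on all entries are finite, see
  \<open>alt_min_finite\<close> below.
\<close>

primrec alt_min ::
  "('w::finite \<Rightarrow> nat^'n) \<Rightarrow> real^'n^'m \<Rightarrow> real^'m \<Rightarrow> nat \<Rightarrow> (ereal^'w) \<times> (ereal^'w)"
  where
    "alt_min \<omega> x y 0 =
      (vec (-\<infinity>),
       \<chi> j. if \<omega> j = 0 then ereal (- (1 / real CARD('m)) * (\<Sum>i\<in>UNIV. y $ i)) else -\<infinity>)"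
  | "alt_min \<omega> x y (Suc k) =
      (let X = map_matrix ereal (exponent_matrix \<omega> x);
           q = snd (alt_min \<omega> x y k);
           p' = maxplus_fit X (X \<boxplus> q + ereal_vec y);
           q' = maxplus_fit X (X \<boxplus> p' - ereal_vec y)
       in (p', q'))"

lemma einfnorm_ereal: "einfnorm (ereal_vec v) = ereal (infnorm v)"
proof -
  have "infnorm v = Max (range (\<lambda>i. \<bar>v $ i\<bar>))"
    unfolding infnorm_cart by (subst cSup_eq_Max) (auto simp: full_SetCompr_eq)
  moreover have "ereal (Max (range (\<lambda>i. \<bar>v $ i\<bar>))) = Max (ereal ` range (\<lambda>i. \<bar>v $ i\<bar>))"
    by (rule mono_Max_commute) (auto simp: mono_def)
  ultimately show ?thesis
    by (simp add: einfnorm_def ereal_vec_def image_image)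
qed

lemma maxplus_mv_ereal: "map_matrix ereal A \<boxplus> ereal_vec u = ereal_vec (A \<boxplus> u)"
proof -
  have "ereal (Max (range (\<lambda>j. A $ i $ j + u $ j))) =
      Max (ereal ` range (\<lambda>j. A $ i $ j + u $ j))" for i
    by (rule mono_Max_commute) (auto simp: mono_def)
  then show ?thesis
    by (simp add: vec_eq_iff maxplus_mv_def ereal_vec_def image_image)
qed

lemma minplus_mv_ereal:
  "(- transpose (map_matrix ereal A)) \<boxplus>' ereal_vec b = ereal_vec ((- transpose A) \<boxplus>' b)"
proof -
  have "ereal (Min (range (\<lambda>i. - A $ i $ j + b $ i))) =
      Min (ereal ` range (\<lambda>i. - A $ i $ j + b $ i))" for j
    by (rule mono_Min_commute) (auto simp: mono_def)
  then show ?thesis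
    by (simp add: vec_eq_iff minplus_mv_def ereal_vec_def transpose_def image_image)
qed

lemma ereal_vec_add: "ereal_vec v + ereal_vec w = ereal_vec (v + w)"
  by (simp add: ereal_vec_def vec_eq_iff)

lemma ereal_vec_diff: "ereal_vec v - ereal_vec w = ereal_vec (v - w)"
  by (simp add: ereal_vec_def vec_eq_iff)

lemma ereal_vec_vec: "vec (ereal r) = ereal_vec (vec r)"
  by (simp add: ereal_vec_def vec_eq_iff)

lemma maxplus_fit_ereal:
  "maxplus_fit (map_matrix ereal A) (ereal_vec b) =
    ereal_vec (let u = (- transpose A) \<boxplus>' b in u + vec (infnorm (A \<boxplus> u - b) / 2))"
  by (simp add: maxplus_fit_def Let_def minplus_mv_ereal maxplus_mv_ereal einfnorm_ereal
      ereal_vec_diff ereal_vec_add ereal_vec_vec)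

lemma alt_min_finite:
  assumes "0 \<in> range \<omega>" "k \<ge> 1"
  shows "alt_min \<omega> x y k =
    (ereal_vec (real_vec (fst (alt_min \<omega> x y k))), ereal_vec (real_vec (snd (alt_min \<omega> x y k))))"
proof -
  let ?X = "exponent_matrix \<omega> x"
  have start: "\<exists>b. map_matrix ereal ?X \<boxplus> snd (alt_min \<omega> x y 0) = ereal_vec b"
  proof -
    let ?q = "snd (alt_min \<omega> x y 0)"
    from assms(1) obtain j0 where j0: "\<omega> j0 = 0" by auto
    have "\<bar>(map_matrix ereal ?X \<boxplus> ?q) $ i\<bar> \<noteq> \<infinity>" for i
    proof -
      let ?S = "range (\<lambda>j. map_matrix ereal ?X $ i $ j + ?q $ j)"
      have "Max ?S \<in> ?S" by (rule Max_in) auto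
      moreover have "s \<noteq> \<infinity>" if "s \<in> ?S" for s
        using that by (auto split: if_splits)
      ultimately have "Max ?S \<noteq> \<infinity>" by blast
      moreover have "map_matrix ereal ?X $ i $ j0 + ?q $ j0 \<le> Max ?S" by (rule Max_ge) auto
      then have "Max ?S \<noteq> -\<infinity>" using j0 by auto
      ultimately show ?thesis by (auto simp: maxplus_mv_def)
    qed
    then have "map_matrix ereal ?X \<boxplus> ?q = ereal_vec (real_vec (map_matrix ereal ?X \<boxplus> ?q))"
      by (simp add: vec_eq_iff ereal_vec_def real_vec_def ereal_real')
    then show ?thesis ..
  qed
  have step: "\<exists>p q. alt_min \<omega> x y (Suc k) = (ereal_vec p, ereal_vec q)"
    if "\<exists>b. map_matrix ereal ?X \<boxplus> snd (alt_min \<omega> x y k) = ereal_vec b" for k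
    using that by (auto simp: Let_def ereal_vec_add ereal_vec_diff maxplus_fit_ereal maxplus_mv_ereal)
  have all: "\<exists>p q. alt_min \<omega> x y (Suc k) = (ereal_vec p, ereal_vec q)" for k
  proof (induction k)
    case 0
    show ?case using step start by blast
  next
    case (Suc k)
    then show ?case
      by (intro step) (auto simp: maxplus_mv_ereal simp del: alt_min.simps)
  qed
  obtain p q where "alt_min \<omega> x y k = (ereal_vec p, ereal_vec q)"
    using all[of "k - 1"] assms(2) by (auto simp del: alt_min.simps)
  then show ?thesis
    by (simp add: real_vec_def ereal_vec_def vec_eq_iff)
qed

end

theory Submission
  imports Defs
begin

text \<open>
  The principal solution \<open>u\<close> of \<open>A \<boxplus> u \<le> b\<close> attains equality in some row, so after the shift
  by half the error the residual has largest entry \<open>c\<close> and smallest entry \<open>- c\<close>, where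
  \<open>c\<close> is its norm. Each iterate \<open>q\<^sup>k\<close> is such a fit. Hence adding \<open>t\<close> to every entry of
  \<open>p\<^sup>k\<close>, which adds \<open>t\<close> to every entry of the residual, changes the loss to \<open>c + \<bar>t\<bar>\<close>; this has a
  kink at \<open>t = 0\<close>, also when \<open>c = 0\<close>.
\<close>

lemma maxplus_mv_add_vec:
  fixes A :: "real^'r^'m"
  shows "A \<boxplus> (u + vec t) = A \<boxplus> u + vec t"
proof -
  have "Max (range (\<lambda>j. A $ i $ j + u $ j + t)) = Max (range (\<lambda>j. A $ i $ j + u $ j)) + t" for i
    using mono_Max_commute[of "\<lambda>s. s + t" "range (\<lambda>j. A $ i $ j + u $ j)"]
    by (simp add: mono_def image_image)
  then show ?thesis
    by (simp add: maxplus_mv_def vec_eq_iff add.assoc)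
qed

text \<open>Residuation: the minimum defining entry \<open>j\<close> of the principal solution runs
  over the bounds that the rows of \<open>b\<close> impose on it.\<close>

lemma maxplus_mv_principal_le:
  fixes A :: "real^'r^'m"
  shows "(A \<boxplus> ((- transpose A) \<boxplus>' b)) $ i \<le> b $ i"
proof -
  have "((- transpose A) \<boxplus>' b) $ j \<le> - A $ i $ j + b $ i" for j
    by (auto simp: minplus_mv_def transpose_def intro!: Min_le)
  then have "A $ i $ j + ((- transpose A) \<boxplus>' b) $ j \<le> b $ i" for j
    by (simp add: algebra_simps)
  then show ?thesis
    by (simp add: maxplus_mv_def)
qed

text \<open>A single column \<open>j\<close> suffices: a row attaining the minimum that defines
  entry \<open>j\<close> is tight.\<close>

lemma maxplus_mv_principal_eq:
  fixes A :: "real^'r^'m"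
  shows "\<exists>i. (A \<boxplus> ((- transpose A) \<boxplus>' b)) $ i = b $ i"
proof -
  fix j :: 'r
  let ?u = "(- transpose A) \<boxplus>' b"
  have "?u $ j = Min (range (\<lambda>i. - A $ i $ j + b $ i))"
    by (simp add: minplus_mv_def transpose_def)
  also have "\<dots> \<in> range (\<lambda>i. - A $ i $ j + b $ i)"
    by (rule Min_in) auto
  finally obtain i where i: "?u $ j = - A $ i $ j + b $ i" by auto
  have "A $ i $ j + ?u $ j \<le> (A \<boxplus> ?u) $ i"
    unfolding maxplus_mv_def by (auto intro: Max_ge)
  then show ?thesis
    using i maxplus_mv_principal_le[of A b i] by (intro exI[of _ i]) linarith
qed

lemma infnorm_cart_Max: "infnorm v = Max (range (\<lambda>i. \<bar>v $ i\<bar>))"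
  unfolding infnorm_cart by (subst cSup_eq_Max) (auto simp: full_SetCompr_eq)

text \<open>The shift by \<open>c\<close> centres the interval \<open>[0, 2 * c]\<close> spanned by
  the entries of \<open>b - A \<boxplus> u\<close> at 0. Both ends are attained, so a further shift
  by \<open>t\<close> pushes one of them outwards by \<open>\<bar>t\<bar>\<close>.\<close>

lemma infnorm_maxplus_fit_shift:
  fixes A :: "real^'r^'m" and b :: "real^'m"
  defines "u \<equiv> (- transpose A) \<boxplus>' b"
  defines "c \<equiv> infnorm (A \<boxplus> u - b) / 2"
  shows "infnorm (b - A \<boxplus> (u + vec c) + vec t) = c + \<bar>t\<bar>"
proof -
  let ?d = "\<lambda>i. b $ i - (A \<boxplus> u) $ i"
  have c: "2 * c = Max (range (\<lambda>i. \<bar>?d i\<bar>))"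
    unfolding c_def by (simp add: infnorm_cart_Max abs_minus_commute)
  have d0: "0 \<le> ?d i" for i
    using maxplus_mv_principal_le[of A b i] by (simp add: u_def)
  have "2 * c \<in> range (\<lambda>i. \<bar>?d i\<bar>)"
    unfolding c by (rule Max_in) auto
  then obtain i1 where i1: "?d i1 = 2 * c" using d0 by auto
  obtain i0 where "(A \<boxplus> u) $ i0 = b $ i0"
    using maxplus_mv_principal_eq[of A b] unfolding u_def by blast
  then have i0: "?d i0 = 0" by simp
  have dc: "?d i \<le> 2 * c" for i
  proof -
    have "\<bar>?d i\<bar> \<le> 2 * c" unfolding c by (rule Max_ge) auto
    then show ?thesis by simp
  qed
  have res: "(b - A \<boxplus> (u + vec c) + vec t) $ i = ?d i - c + t" for i
    by (simp add: maxplus_mv_add_vec)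
  have "Max (range (\<lambda>i. \<bar>?d i - c + t\<bar>)) = c + \<bar>t\<bar>"
  proof (rule Max_eqI)
    show "s \<le> c + \<bar>t\<bar>" if "s \<in> range (\<lambda>i. \<bar>?d i - c + t\<bar>)" for s
    proof -
      from that obtain i where "s = \<bar>?d i - c + t\<bar>" by auto
      then show ?thesis using d0[of i] dc[of i] by linarith
    qed
    have "0 \<le> c" using d0[of i1] i1 by simp
    \<comment> \<open>Row \<open>i1\<close> has residual \<open>c + t\<close> and row
      \<open>i0\<close> has \<open>- c + t\<close>; as \<open>c\<close> is nonnegative, the row is
      chosen so that both summands have the same sign.\<close>
    then have "c + \<bar>t\<bar> = \<bar>?d (if t \<ge> 0 then i1 else i0) - c + t\<bar>"
      using i0 i1 by (cases "t \<ge> 0") auto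
    then show "c + \<bar>t\<bar> \<in> range (\<lambda>i. \<bar>?d i - c + t\<bar>)" by (rule range_eqI)
  qed simp
  then show ?thesis unfolding infnorm_cart_Max res .
qed

text \<open>The difference quotient at 0 has one-sided limits 1 and -1.\<close>

lemma not_differentiable_abs: "\<not> (\<lambda>t::real. \<bar>t\<bar>) differentiable (at 0)"
proof
  assume "(\<lambda>t::real. \<bar>t\<bar>) differentiable (at 0)"
  then obtain D where "((\<lambda>t::real. \<bar>t\<bar>) has_real_derivative D) (at 0)"
    using real_differentiableE by blast
  then have D: "(\<lambda>t::real. \<bar>t\<bar> / t) \<midarrow>0\<rightarrow> D"
    by (simp add: DERIV_def)
  have "((\<lambda>t::real. \<bar>t\<bar> / t) \<longlongrightarrow> 1) (at_right 0)"
    by (rule tendsto_eventually) (auto simp: eventually_at_filter)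
  moreover have "((\<lambda>t::real. \<bar>t\<bar> / t) \<longlongrightarrow> -1) (at_left 0)"
    by (rule tendsto_eventually) (auto simp: eventually_at_filter)
  ultimately show False
    using D tendsto_unique[of "at_right (0::real)" "\<lambda>t. \<bar>t\<bar> / t" 1 D]
      tendsto_unique[of "at_left (0::real)" "\<lambda>t. \<bar>t\<bar> / t" "-1" D]
    by (auto simp: filterlim_at_split)
qed

theorem theorem3p5:
  fixes x :: "real^'n^'m" and y :: "real^'m"
    and W :: "(nat^'n) set" and \<omega> :: "'w::finite \<Rightarrow> nat^'n"
    and k :: nat
  assumes "finite W" and "0 \<in> W"
    and "bij_betw \<omega> UNIV W"
    and "k \<ge> 1"
  shows "\<not> loss \<omega> x y differentiable
    (at (real_vec (fst (alt_min \<omega> x y k)), real_vec (snd (alt_min \<omega> x y k))))"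
proof
  let ?X = "exponent_matrix \<omega> x"
  define p where "p = real_vec (fst (alt_min \<omega> x y k))"
  define q where "q = real_vec (snd (alt_min \<omega> x y k))"
  assume "loss \<omega> x y differentiable
    (at (real_vec (fst (alt_min \<omega> x y k)), real_vec (snd (alt_min \<omega> x y k))))"
  then have diff: "loss \<omega> x y differentiable (at (p, q))"
    by (simp add: p_def q_def)
  have "0 \<in> range \<omega>" using assms(2,3) by (simp add: bij_betw_def)
  \<comment> \<open>Finiteness makes \<open>real_vec\<close> faithful here; it would send the
    infinite entries of round 0 to 0.\<close>
  from alt_min_finite[OF this assms(4), of x y]
  have pq: "alt_min \<omega> x y k = (ereal_vec p, ereal_vec q)"
    by (simp add: p_def q_def)
  obtain k' where k: "k = Suc k'" using assms(4) by (cases k) auto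
  define b where "b = ?X \<boxplus> p - y"
  define u where "u = (- transpose ?X) \<boxplus>' b"
  define c where "c = infnorm (?X \<boxplus> u - b) / 2"
  \<comment> \<open>Within a round, the second component is fitted to data built from the first
    component of the same round, so the residual at \<open>(p, q)\<close> is exactly that of a fit
    to \<open>b\<close>.\<close>
  have "snd (alt_min \<omega> x y k) =
      maxplus_fit (map_matrix ereal ?X) (map_matrix ereal ?X \<boxplus> fst (alt_min \<omega> x y k) - ereal_vec y)"
    by (simp add: k Let_def)
  then have "ereal_vec q = ereal_vec (u + vec c)"
    by (simp add: pq maxplus_mv_ereal ereal_vec_diff maxplus_fit_ereal Let_def b_def u_def c_def)
  then have q: "q = u + vec c"
    by (simp add: ereal_vec_def vec_eq_iff)
  have "loss \<omega> x y (p + vec t, q) = c + \<bar>t\<bar>" for t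
  proof -
    have "loss \<omega> x y (p + vec t, q) = infnorm (b - ?X \<boxplus> (u + vec c) + vec t)"
      by (simp add: loss_def q maxplus_mv_add_vec b_def algebra_simps)
    then show ?thesis
      using infnorm_maxplus_fit_shift[of b ?X t] by (simp add: u_def c_def)
  qed
  \<comment> \<open>Writing \<open>vec t\<close> as \<open>t *\<^sub>R vec 1\<close> exhibits an
    affine curve through \<open>(p, q)\<close>, to which the chain rule applies.\<close>
  then have eq: "(\<lambda>t. \<bar>t\<bar>) = (\<lambda>t. loss \<omega> x y (p + t *\<^sub>R vec 1, q) - c)"
    by (simp add: fun_eq_iff vec_eq_iff scaleR_vec_def vec_def)
  have "(\<lambda>t. (p + t *\<^sub>R vec 1, q)) differentiable (at (0::real))"
    unfolding differentiable_def by (intro exI) (auto intro!: derivative_eq_intros)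
  moreover have "loss \<omega> x y differentiable (at (p + (0::real) *\<^sub>R vec 1, q))"
    using diff by simp
  ultimately have "(\<lambda>t. \<bar>t::real\<bar>) differentiable (at 0)"
    unfolding eq
    by (intro differentiable_diff differentiable_const
        differentiable_compose[of "loss \<omega> x y" "\<lambda>t. (p + t *\<^sub>R vec 1, q)"])
  then show False using not_differentiable_abs by blast
qed

end
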